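(* Let $\Pi^{(0)}$ and $\Pi^{(i)}$, $i=1,\dots,I$, be independent exchangeable random partitions of $\mathbb{N}$. For positive integers $n_1(t),\dots,n_I(t)$, $t=1,2,\dots$, let $K_{i,t}=|\Pi^{(i)}_{n_i(t)}|$, $K_t=\sum_{i=1}^IK_{i,t}$, $D_{i,t}=|\Pi^{(0)}_{K_{i,t}}|$, $D_t=|\Pi^{(0)}_{K_t}|$, and set $q^{(0)}_m(k):=\mathbb{P}\{|\Pi^{(0)}_m|=k\}$. Assume that $\lim_{t\to\infty}n_i(t)=+\infty$ for every $i=1,\dots,I$. (i) If, for every $i=1,\dots,I$, $|\Pi^{(i)}_n|$ converges a.s. to a (finite) positive random variable $K_i$ as $n\to+\infty$, then for every $k\ge1$ and every $i$ $$\lim_{t\to+\infty}\mathbb{P}\{D_{i,t}=k\}=\sum_{m\ge k}\mathbb{P}\{K_i=m\}\,q^{(0)}_m(k),$$ and $$\lim_{t\to+\infty}\mathbb{P}\{D_t=k\}=\sum_{m\ge\max(I,k)}\ \sum_{\substack{m_1+\dots+m_I=m,\\1\le m_i}}q^{(0)}_m(k)\prod_{i=1}^I\mathbb{P}\{K_i=m_i\}.$$ (ii) If, for every $i=1,\dots,I$, $|\Pi^{(i)}_n|/b_n$ converges a.s. to a strictly positive random variable $D^{(i)}_\infty$ for a suitable diverging sequence $b_n$, and $|\Pi^{(0)}_n|$ converges a.s. to a (finite) positive random variable $K_0$ as $n\to+\infty$, then, for every $k\ge1$ and every $i$, $$\lim_{t\to+\infty}\mathbb{P}\{D_t=k\}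=\lim_{t\to+\infty}\mathbb{P}\{D_{i,t}=k\}=\mathbb{P}\{K_0=k\}.$$
   Context: A random partition of $\mathbb{N}$ is a sequence $\Pi=(\Pi_n)_{n\ge1}$ with $\Pi_n$ a random partition of $\{1,\dots,n\}$, consistent under restriction ($\Pi_m$ is the restriction of $\Pi_n$ to $\{1,\dots,m\}$ for $m<n$); $|\Pi_n|$ is its number of blocks. It is exchangeable if the law of each $\Pi_n$ is invariant under permutations of $\{1,\dots,n\}$. A diverging sequence is one tending to $+\infty$. *)

theory Defs
  imports
    "HOL-Probability.Probability"
    "HOL-Combinatorics.Permutations"
    "HOL-Library.Disjoint_Sets"
begin

text \<open>A random partition of the positive integers is a sequence \<open>\<pi> n\<close>, \<open>n \<ge> 1\<close>; the value
  \<open>\<pi> 0\<close> is unconstrained.\<close>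

definition partition_space :: "nat \<Rightarrow> nat set set measure" where
  "partition_space n = count_space {P. partition_on {1..n} P}"

definition restrict_partition :: "nat \<Rightarrow> nat set set \<Rightarrow> nat set set" where
  "restrict_partition m P = (\<lambda>B. B \<inter> {1..m}) ` P - {{}}"

definition random_partition :: "'a measure \<Rightarrow> (nat \<Rightarrow> 'a \<Rightarrow> nat set set) \<Rightarrow> bool" where
  "random_partition M \<pi> \<longleftrightarrow>
     (\<forall>n\<ge>1. \<pi> n \<in> measurable M (partition_space n)) \<and>
     (\<forall>m n. 1 \<le> m \<longrightarrow> m < n \<longrightarrow>
        (\<forall>\<omega>\<in>space M. \<pi> m \<omega> = restrict_partition m (\<pi> n \<omega>)))"

definition exchangeable :: "'a measure \<Rightarrow> (nat \<Rightarrow> 'a \<Rightarrow> nat set set) \<Rightarrow> bool" where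
  "exchangeable M \<pi> \<longleftrightarrow>
     (\<forall>n\<ge>1. \<forall>\<sigma>. \<sigma> permutes {1..n} \<longrightarrow>
        distr M (partition_space n) (\<lambda>\<omega>. (\<lambda>B. \<sigma> ` B) ` \<pi> n \<omega>) =
        distr M (partition_space n) (\<pi> n))"

text \<open>Independence concerns the whole sequences \<open>(\<pi>\<^sub>n)\<^sub>n\<close>, as random elements of the
  product of the finite partition spaces.\<close>

definition independent_partitions ::
    "'a measure \<Rightarrow> (nat \<Rightarrow> nat \<Rightarrow> 'a \<Rightarrow> nat set set) \<Rightarrow> nat set \<Rightarrow> bool" where
  "independent_partitions M \<pi> J \<longleftrightarrow>
     prob_space.indep_vars M (\<lambda>_. PiM {1..} partition_space)
       (\<lambda>i \<omega>. \<lambda>n\<in>{1..}. \<pi> i n \<omega>) J"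

definition converges_as_to_positive ::
    "'a measure \<Rightarrow> (nat \<Rightarrow> 'a \<Rightarrow> real) \<Rightarrow> ('a \<Rightarrow> real) \<Rightarrow> bool" where
  "converges_as_to_positive M X Y \<longleftrightarrow>
     Y \<in> borel_measurable M \<and> (AE \<omega> in M. 0 < Y \<omega>) \<and>
     (AE \<omega> in M. (\<lambda>n. X n \<omega>) \<longlonglongrightarrow> Y \<omega>)"

definition block_count :: "(nat \<Rightarrow> 'a \<Rightarrow> nat set set) \<Rightarrow> nat \<Rightarrow> 'a \<Rightarrow> nat" where
  "block_count \<pi> n \<omega> = card (\<pi> n \<omega>)"

text \<open>In a family \<open>\<pi> i\<close>, index \<open>0\<close> is the partition evaluated at the random numbers of blocks of
  the partitions \<open>\<pi> i\<close>, \<open>i = 1, \<dots>, I\<close>; the sample size of group \<open>i\<close> at time \<open>t\<close> is \<open>n i t\<close>.\<close>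

definition K_group ::
    "(nat \<Rightarrow> nat \<Rightarrow> 'a \<Rightarrow> nat set set) \<Rightarrow> (nat \<Rightarrow> nat \<Rightarrow> nat) \<Rightarrow> nat \<Rightarrow> nat \<Rightarrow> 'a \<Rightarrow> nat" where
  "K_group \<pi> n i t \<omega> = block_count (\<pi> i) (n i t) \<omega>"

definition K_total ::
    "(nat \<Rightarrow> nat \<Rightarrow> 'a \<Rightarrow> nat set set) \<Rightarrow> (nat \<Rightarrow> nat \<Rightarrow> nat) \<Rightarrow> nat \<Rightarrow> nat \<Rightarrow> 'a \<Rightarrow> nat" where
  "K_total \<pi> n I t \<omega> = (\<Sum>i\<in>{1..I}. K_group \<pi> n i t \<omega>)"

definition D_group ::
    "(nat \<Rightarrow> nat \<Rightarrow> 'a \<Rightarrow> nat set set) \<Rightarrow> (nat \<Rightarrow> nat \<Rightarrow> nat) \<Rightarrow> nat \<Rightarrow> nat \<Rightarrow> 'a \<Rightarrow> nat" where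
  "D_group \<pi> n i t \<omega> = block_count (\<pi> 0) (K_group \<pi> n i t \<omega>) \<omega>"

definition D_total ::
    "(nat \<Rightarrow> nat \<Rightarrow> 'a \<Rightarrow> nat set set) \<Rightarrow> (nat \<Rightarrow> nat \<Rightarrow> nat) \<Rightarrow> nat \<Rightarrow> nat \<Rightarrow> 'a \<Rightarrow> nat" where
  "D_total \<pi> n I t \<omega> = block_count (\<pi> 0) (K_total \<pi> n I t \<omega>) \<omega>"

definition q0 :: "'a measure \<Rightarrow> (nat \<Rightarrow> nat \<Rightarrow> 'a \<Rightarrow> nat set set) \<Rightarrow> nat \<Rightarrow> nat \<Rightarrow> real" where
  "q0 M \<pi> m k = \<P>(\<omega> in M. block_count (\<pi> 0) m \<omega> = k)"

end

theory Submission
  imports Defs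
begin

text \<open>In case (i) the block counts are integers that converge almost surely, so they are
  eventually constant, and hence so is the count of \<open>\<pi> 0\<close> evaluated at their sum. The limit law
  is computed by conditioning on the limits of the counts; these inherit independence from
  the finite sample sizes, because both sides of the product formula converge. In
  case (ii) the random index tends to infinity, where the count of \<open>\<pi> 0\<close> is eventually
  constant. A sum over an arbitrary nonempty set \<open>J\<close> of groups covers \<open>D_group\<close>
  and \<open>D_total\<close> at once.\<close>

section \<open>Integer-valued limits and elementary facts on block counts\<close>

text \<open>The naturals are closed in the reals, so the limit is a natural number, and a natural
  number at distance less than 1 from it is equal to it. Writing the limit as
  \<open>nat \<lfloor>x\<rfloor>\<close> makes it an explicit measurable function of
  \<open>x\<close>.\<close>

lemma tendsto_of_nat_imp_eventually_eq:
  fixes f :: "nat \<Rightarrow> nat" and x :: real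
  assumes "(\<lambda>n. real (f n)) \<longlonglongrightarrow> x"
  shows "x = real (nat \<lfloor>x\<rfloor>)" and "\<forall>\<^sub>F n in sequentially. f n = nat \<lfloor>x\<rfloor>"
proof -
  have "x \<in> \<nat>"
    using closed_sequentially[OF closed_Nats _ assms] by auto
  then obtain m where m: "x = real m"
    by (auto elim: Nats_cases)
  have "\<forall>\<^sub>F n in sequentially. dist (real (f n)) x < 1"
    using tendstoD[OF assms, of 1] by simp
  then have "\<forall>\<^sub>F n in sequentially. f n = m"
    by eventually_elim (simp add: m dist_real_def)
  then show "x = real (nat \<lfloor>x\<rfloor>)" and "\<forall>\<^sub>F n in sequentially. f n = nat \<lfloor>x\<rfloor>"
    by (simp_all add: m)
qed

lemma measurable_count_space_UNIV:
  "f \<in> measurable M (count_space A) \<Longrightarrow> f \<in> measurable M (count_space UNIV)"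
  using measurable_comp[of f M "count_space A" id "count_space UNIV"] by simp

text \<open>Every block has at least one element, and the block sizes add up to
  \<open>card A\<close>.\<close>

lemma card_partition_on_le:
  assumes "finite A" "partition_on A P"
  shows "card P \<le> card A"
proof -
  have fin: "finite p" if "p \<in> P" for p
    using assms that by (metis finite_subset partition_onD1 Union_upper)
  have "card P = (\<Sum>p\<in>P. 1)"
    by simp
  also have "\<dots> \<le> (\<Sum>p\<in>P. card p)"
  proof (rule sum_mono)
    fix p assume "p \<in> P"
    then have "p \<noteq> {}"
      using partition_onD3[OF assms(2)] by metis
    then show "1 \<le> card p"
      using fin[OF \<open>p \<in> P\<close>] by (simp add: Suc_le_eq card_gt_0_iff)
  qed
  also have "\<dots> = card A"
    using product_partition[OF assms(2) fin] by simp
  finally show ?thesis .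
qed

text \<open>A partition of a nonempty set has a block, which gives the codomain
  \<open>{1..}\<close>. This codomain matters because block counts later serve as indices into
  \<open>\<pi> 0\<close>, whose value at index 0 is unconstrained. The upper bound \<open>m\<close>
  is the reason why the limiting series start at \<open>k\<close>.\<close>

lemma
  assumes "random_partition M \<pi>" "1 \<le> m"
  shows measurable_block_count: "block_count \<pi> m \<in> measurable M (count_space {1..})"
    and block_count_ge_1: "\<And>\<omega>. \<omega> \<in> space M \<Longrightarrow> 1 \<le> block_count \<pi> m \<omega>"
    and block_count_le: "\<And>\<omega>. \<omega> \<in> space M \<Longrightarrow> block_count \<pi> m \<omega> \<le> m"
proof -
  have meas: "\<pi> m \<in> measurable M (partition_space m)"
    using assms by (simp add: random_partition_def)
  have part: "partition_on {1..m} P" if "P \<in> space (partition_space m)" for P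
    using that by (simp add: partition_space_def)
  have pos: "1 \<le> card P" if "P \<in> space (partition_space m)" for P
  proof -
    have "P \<noteq> {}"
      using partition_onD1[OF part[OF that]] assms(2) by auto
    then show ?thesis
      using finite_elements[OF _ part[OF that]] by (simp add: Suc_le_eq card_gt_0_iff)
  qed
  have "card \<in> measurable (partition_space m) (count_space {1..})"
    using pos by (simp add: partition_space_def)
  then show "block_count \<pi> m \<in> measurable M (count_space {1..})"
    using measurable_comp[OF meas] by (simp add: block_count_def[abs_def] comp_def)
  show "1 \<le> block_count \<pi> m \<omega>" if "\<omega> \<in> space M" for \<omega>
    using pos measurable_space[OF meas that] by (simp add: block_count_def)
  show "block_count \<pi> m \<omega> \<le> m" if "\<omega> \<in> space M" for \<omega>
    using card_partition_on_le[OF _ part] measurable_space[OF meas that]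
    by (fastforce simp add: block_count_def)
qed

section \<open>Limits of probabilities and random indices\<close>

lemma pred_and_Ball_eq:
  assumes "finite J" "Measurable.pred M R"
    and "\<And>i. i \<in> J \<Longrightarrow> L i \<in> measurable M (count_space UNIV)"
  shows "Measurable.pred M (\<lambda>\<omega>. R \<omega> \<and> (\<forall>i\<in>J. L i \<omega> = v i))"
proof -
  have "Measurable.pred M (\<lambda>\<omega>. L i \<omega> = v i)" if "i \<in> J" for i
    using assms(3)[OF that] by measurable
  then show ?thesis
    using assms(1,2) by (intro pred_intros_logic pred_intros_finite) auto
qed

text \<open>The indicators of the events are almost surely eventually equal to the indicator of
  \<open>Q\<close>, and they are bounded by 1, so dominated convergence applies.\<close>

lemma (in prob_space) prob_tendsto_of_AE_eventually_iff:
  assumes [measurable]: "\<And>t. Measurable.pred M (P t)" "Measurable.pred M Q"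
    and "AE \<omega> in M. \<forall>\<^sub>F t in sequentially. P t \<omega> \<longleftrightarrow> Q \<omega>"
  shows "(\<lambda>t. \<P>(\<omega> in M. P t \<omega>)) \<longlonglongrightarrow> \<P>(\<omega> in M. Q \<omega>)"
proof -
  have "(\<lambda>t. \<integral>\<omega>. indicator {\<omega> \<in> space M. P t \<omega>} \<omega> \<partial>M)
      \<longlonglongrightarrow> (\<integral>\<omega>. indicator {\<omega> \<in> space M. Q \<omega>} \<omega> \<partial>M :: real)"
  proof (rule integral_dominated_convergence[where w = "\<lambda>_. 1"])
    show "AE \<omega> in M. (\<lambda>t. indicator {\<omega> \<in> space M. P t \<omega>} \<omega>)
        \<longlonglongrightarrow> (indicator {\<omega> \<in> space M. Q \<omega>} \<omega> :: real)"
      using assms(3)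
    proof eventually_elim
      case (elim \<omega>)
      show ?case
        by (rule tendsto_eventually) (use elim in eventually_elim, simp add: indicator_def)
    qed
  qed (auto simp: indicator_def)
  then show ?thesis
    by simp
qed

text \<open>Countable additivity over the values of \<open>S\<close>. Restricting to
  \<open>A\<close> leaves out indices at which \<open>R m\<close> may fail to be measurable, such as
  0 for block counts.\<close>

lemma (in prob_space) has_sum_prob_random_index:
  fixes S :: "'a \<Rightarrow> nat"
  assumes S: "S \<in> measurable M (count_space UNIV)"
    and R: "\<And>m. m \<in> A \<Longrightarrow> Measurable.pred M (R m)"
    and A: "\<And>\<omega>. \<omega> \<in> space M \<Longrightarrow> R (S \<omega>) \<omega> \<Longrightarrow> S \<omega> \<in> A"
  shows "((\<lambda>m. \<P>(\<omega> in M. S \<omega> = m \<and> R m \<omega>)) has_sum \<P>(\<omega> in M. R (S \<omega>) \<omega>)) A"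
proof -
  \<comment> \<open>Empty sets outside \<open>A\<close> turn the family into a sequence over all
    naturals, as countable additivity requires; these zero terms are dropped again at the
    end.\<close>
  define F where "F m = (if m \<in> A then {\<omega> \<in> space M. S \<omega> = m \<and> R m \<omega>} else {})" for m
  have "F m \<in> events" for m
    using S R[of m] unfolding F_def by (cases "m \<in> A") simp_all
  then have "range F \<subseteq> events"
    by blast
  moreover have "disjoint_family F"
    by (auto simp: disjoint_family_on_def F_def)
  ultimately have "(\<lambda>m. prob (F m)) sums prob (\<Union>m. F m)"
    by (rule finite_measure_UNION)
  moreover have "(\<Union>m. F m) = {\<omega> \<in> space M. R (S \<omega>) \<omega>}"
    using A by (auto simp: F_def split: if_splits)
  ultimately have "((\<lambda>m. prob (F m)) has_sum \<P>(\<omega> in M. R (S \<omega>) \<omega>)) UNIV"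
    by (auto intro: sums_nonneg_imp_has_sum)
  then show ?thesis
    by (rule has_sum_cong_neutral[THEN iffD1, rotated -1]) (auto simp: F_def)
qed

text \<open>The index takes countably many values, and at each fixed value in \<open>{1..}\<close>
  the block count is measurable.\<close>

lemma measurable_block_count_random_index:
  assumes "random_partition M \<pi>" "S \<in> measurable M (count_space {1..})"
  shows "(\<lambda>\<omega>. block_count \<pi> (S \<omega>) \<omega>) \<in> measurable M (count_space UNIV)"
proof (rule measurable_compose_countable'[OF _ assms(2)])
  show "block_count \<pi> m \<in> measurable M (count_space UNIV)" if "m \<in> {1..}" for m
    using measurable_count_space_UNIV[OF measurable_block_count[OF assms(1)]] that by simp
qed simp

section \<open>Independence of block counts and of their limits\<close>

text \<open>Each condition on a block count is the preimage, under the whole sequence of partitions,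
  of a cylinder set in the product space, so independence of the sequences gives the
  product.\<close>

lemma (in prob_space) prob_block_counts_indep:
  assumes ind: "independent_partitions M \<pi> {0..I}"
    and J: "J \<subseteq> {1..I}" and m: "1 \<le> m" and N: "\<And>i. i \<in> J \<Longrightarrow> 1 \<le> N i"
  shows "\<P>(\<omega> in M. block_count (\<pi> 0) m \<omega> = k \<and> (\<forall>i\<in>J. block_count (\<pi> i) (N i) \<omega> = v i))
    = q0 M \<pi> m k * (\<Prod>i\<in>J. \<P>(\<omega> in M. block_count (\<pi> i) (N i) \<omega> = v i))"
proof -
  \<comment> \<open>Overriding both functions at 0 puts the condition on \<open>\<pi> 0\<close> on
    the same footing as those for \<open>J\<close>, which does not contain 0.\<close>
  define N' where "N' = N(0 := m)"
  define v' where "v' = v(0 := k)"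
  define X where "X i \<omega> = (\<lambda>n\<in>{1..}. \<pi> i n \<omega>)" for i \<omega>
  define A where "A i = {p \<in> space (PiM {1..} partition_space). card (p (N' i)) = v' i}" for i
  have J0: "0 \<notin> J" "finite J"
    using J finite_subset[OF J] by auto
  have N': "1 \<le> N' i" if "i \<in> insert 0 J" for i
    using that m N by (auto simp: N'_def)
  have A: "A i \<in> sets (PiM {1..} partition_space)" if "i \<in> insert 0 J" for i
  proof -
    have "(\<lambda>p. card (p (N' i))) \<in> measurable (PiM {1..} partition_space) (count_space UNIV)"
      using N'[OF that]
      by (intro measurable_compose[OF measurable_component_singleton])
        (auto simp: partition_space_def)
    then show ?thesis
      unfolding A_def by measurable
  qed
  have ind': "indep_vars (\<lambda>_. PiM {1..} partition_space) X {0..I}"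
    using ind by (simp add: independent_partitions_def X_def[abs_def])
  have X: "X i -` A i \<inter> space M = {\<omega> \<in> space M. block_count (\<pi> i) (N' i) \<omega> = v' i}"
    if "i \<in> insert 0 J" for i
  proof -
    have "X i \<in> measurable M (PiM {1..} partition_space)"
      using ind' that J by (auto simp: indep_vars_def)
    from measurable_space[OF this] show ?thesis
      using N'[OF that] by (auto simp: A_def X_def block_count_def)
  qed
  have "prob (\<Inter>i\<in>insert 0 J. X i -` A i \<inter> space M)
      = (\<Prod>i\<in>insert 0 J. prob (X i -` A i \<inter> space M))"
    using J0 J A by (intro indep_varsD[OF ind']) auto
  also have "(\<Inter>i\<in>insert 0 J. X i -` A i \<inter> space M)
      = (\<Inter>i\<in>insert 0 J. {\<omega> \<in> space M. block_count (\<pi> i) (N' i) \<omega> = v' i})"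
    using X by auto
  also have "\<dots> = {\<omega> \<in> space M. block_count (\<pi> 0) m \<omega> = k \<and>
      (\<forall>i\<in>J. block_count (\<pi> i) (N i) \<omega> = v i)}"
    using J0 by (auto simp: N'_def v'_def split: if_splits)
  also have "(\<Prod>i\<in>insert 0 J. prob (X i -` A i \<inter> space M))
      = (\<Prod>i\<in>insert 0 J. \<P>(\<omega> in M. block_count (\<pi> i) (N' i) \<omega> = v' i))"
    using X by (intro prod.cong) auto
  also have "\<dots> = q0 M \<pi> m k * (\<Prod>i\<in>J. \<P>(\<omega> in M. block_count (\<pi> i) (N i) \<omega> = v i))"
    using J0 by (auto simp: N'_def v'_def q0_def intro!: prod.cong)
  finally show ?thesis .
qed

text \<open>With a common sample size for all groups in \<open>J\<close>, the product formula holds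
  at every stage. As the sample size grows, both sides converge, and uniqueness of limits carries
  the formula over to the eventual values \<open>L i\<close>.\<close>

lemma (in prob_space) prob_limit_block_counts_indep:
  assumes rp: "\<And>i. i \<in> {0..I} \<Longrightarrow> random_partition M (\<pi> i)"
    and ind: "independent_partitions M \<pi> {0..I}"
    and J: "J \<subseteq> {1..I}" and m: "1 \<le> m"
    and L: "\<And>i. i \<in> J \<Longrightarrow> L i \<in> measurable M (count_space UNIV)"
    and conv: "\<And>i. i \<in> J \<Longrightarrow>
      AE \<omega> in M. \<forall>\<^sub>F N in sequentially. block_count (\<pi> i) N \<omega> = L i \<omega>"
  shows "\<P>(\<omega> in M. block_count (\<pi> 0) m \<omega> = k \<and> (\<forall>i\<in>J. L i \<omega> = v i))
    = q0 M \<pi> m k * (\<Prod>i\<in>J. \<P>(\<omega> in M. L i \<omega> = v i))"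
proof -
  have fin: "finite J"
    using finite_subset[OF J] by simp
  \<comment> \<open>Sample sizes are written \<open>Suc N\<close> to avoid 0, where
    \<open>\<pi> i\<close> need not be measurable.\<close>
  have bc: "block_count (\<pi> i) (Suc N) \<in> measurable M (count_space UNIV)" if "i \<in> insert 0 J" for i N
    using that J by (intro measurable_count_space_UNIV[OF measurable_block_count[OF rp]]) auto
  have m': "Suc (m - 1) = m"
    using m by simp
  have [measurable]: "block_count (\<pi> 0) m \<in> measurable M (count_space UNIV)"
    using bc[of 0 "m - 1"] m' by simp
  have conv': "AE \<omega> in M. \<forall>\<^sub>F N in sequentially. block_count (\<pi> i) (Suc N) \<omega> = L i \<omega>"
    if "i \<in> J" for i
    using conv[OF that] by eventually_elim (rule eventually_compose_filterlim[OF _ filterlim_Suc])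
  have "(\<lambda>N. \<P>(\<omega> in M. block_count (\<pi> 0) m \<omega> = k \<and> (\<forall>i\<in>J. block_count (\<pi> i) (Suc N) \<omega> = v i)))
      \<longlonglongrightarrow> \<P>(\<omega> in M. block_count (\<pi> 0) m \<omega> = k \<and> (\<forall>i\<in>J. L i \<omega> = v i))"
  proof (rule prob_tendsto_of_AE_eventually_iff)
    have "AE \<omega> in M. \<forall>i\<in>J. \<forall>\<^sub>F N in sequentially. block_count (\<pi> i) (Suc N) \<omega> = L i \<omega>"
      using conv' fin by (simp add: AE_finite_all)
    then show "AE \<omega> in M. \<forall>\<^sub>F N in sequentially.
        (block_count (\<pi> 0) m \<omega> = k \<and> (\<forall>i\<in>J. block_count (\<pi> i) (Suc N) \<omega> = v i)) \<longleftrightarrow>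
        (block_count (\<pi> 0) m \<omega> = k \<and> (\<forall>i\<in>J. L i \<omega> = v i))"
    proof eventually_elim
      case (elim \<omega>)
      then have "\<forall>\<^sub>F N in sequentially. \<forall>i\<in>J. block_count (\<pi> i) (Suc N) \<omega> = L i \<omega>"
        using fin by (simp add: eventually_ball_finite_distrib)
      then show ?case
        by eventually_elim auto
    qed
    show "Measurable.pred M (\<lambda>\<omega>. block_count (\<pi> 0) m \<omega> = k \<and> (\<forall>i\<in>J. L i \<omega> = v i))"
      using L fin by (intro pred_and_Ball_eq) auto
    show "Measurable.pred M
        (\<lambda>\<omega>. block_count (\<pi> 0) m \<omega> = k \<and> (\<forall>i\<in>J. block_count (\<pi> i) (Suc N) \<omega> = v i))" for N
      using bc fin by (intro pred_and_Ball_eq) auto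
  qed
  moreover have "(\<lambda>N. q0 M \<pi> m k * (\<Prod>i\<in>J. \<P>(\<omega> in M. block_count (\<pi> i) (Suc N) \<omega> = v i)))
      \<longlonglongrightarrow> q0 M \<pi> m k * (\<Prod>i\<in>J. \<P>(\<omega> in M. L i \<omega> = v i))"
  proof (intro tendsto_mult tendsto_const tendsto_prod prob_tendsto_of_AE_eventually_iff)
    fix i assume i: "i \<in> J"
    show "AE \<omega> in M. \<forall>\<^sub>F N in sequentially. (block_count (\<pi> i) (Suc N) \<omega> = v i) = (L i \<omega> = v i)"
      using conv'[OF i]
    proof eventually_elim
      case (elim \<omega>)
      then show ?case
        by eventually_elim simp
    qed
    show "Measurable.pred M (\<lambda>\<omega>. L i \<omega> = v i)"
      using L[OF i] by measurable
    show "Measurable.pred M (\<lambda>\<omega>. block_count (\<pi> i) (Suc N) \<omega> = v i)" for N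
      using bc[OF insertI2[OF i]] by measurable
  qed
  moreover have "\<P>(\<omega> in M. block_count (\<pi> 0) m \<omega> = k \<and> (\<forall>i\<in>J. block_count (\<pi> i) (Suc N) \<omega> = v i))
      = q0 M \<pi> m k * (\<Prod>i\<in>J. \<P>(\<omega> in M. block_count (\<pi> i) (Suc N) \<omega> = v i))" for N
    using prob_block_counts_indep[OF ind J m, of "\<lambda>_. Suc N" k v] by simp
  ultimately show ?thesis
    using LIMSEQ_unique by simp
qed

section \<open>Sums of positive counts as random indices\<close>

text \<open>No summand exceeds the total \<open>m\<close>, so the set lies in a finite function
  space.\<close>

lemma finite_funcset_sum_eq:
  fixes m :: nat
  assumes "finite J"
  shows "finite {v \<in> J \<rightarrow>\<^sub>E {1..}. (\<Sum>i\<in>J. v i) = m}"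
proof (rule finite_subset)
  show "{v \<in> J \<rightarrow>\<^sub>E {1..}. (\<Sum>i\<in>J. v i) = m} \<subseteq> J \<rightarrow>\<^sub>E {..m}"
  proof
    fix v assume v: "v \<in> {v \<in> J \<rightarrow>\<^sub>E {1..}. (\<Sum>i\<in>J. v i) = m}"
    then have "v i \<le> m" if "i \<in> J" for i
      using member_le_sum[of i J v] that assms by simp
    with v show "v \<in> J \<rightarrow>\<^sub>E {..m}"
      by (simp add: PiE_iff)
  qed
  show "finite (J \<rightarrow>\<^sub>E {..m})"
    using assms by (intro finite_PiE) auto
qed

text \<open>The event splits according to the vector of values of the \<open>L i\<close>, and only
  finitely many vectors have sum \<open>m\<close>.\<close>

lemma (in prob_space) prob_sum_eq_and:
  fixes L :: "'i \<Rightarrow> 'a \<Rightarrow> nat"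
  assumes fin: "finite J"
    and L: "\<And>i. i \<in> J \<Longrightarrow> L i \<in> measurable M (count_space {1..})"
    and R: "Measurable.pred M R"
  shows "\<P>(\<omega> in M. (\<Sum>i\<in>J. L i \<omega>) = m \<and> R \<omega>)
    = (\<Sum>v\<in>{v \<in> J \<rightarrow>\<^sub>E {1..}. (\<Sum>i\<in>J. v i) = m}. \<P>(\<omega> in M. R \<omega> \<and> (\<forall>i\<in>J. L i \<omega> = v i)))"
    (is "_ = (\<Sum>v\<in>?V. prob (?F v))")
proof -
  have L': "L i \<in> measurable M (count_space UNIV)" if "i \<in> J" for i
    by (rule measurable_count_space_UNIV[OF L[OF that]])
  have pos: "1 \<le> L i \<omega>" if "i \<in> J" "\<omega> \<in> space M" for i \<omega>
    using measurable_space[OF L[OF that(1)] that(2)] by simp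
  have eq: "{\<omega> \<in> space M. (\<Sum>i\<in>J. L i \<omega>) = m \<and> R \<omega>} = (\<Union>v\<in>?V. ?F v)"
  proof (intro equalityI subsetI)
    fix \<omega> assume "\<omega> \<in> {\<omega> \<in> space M. (\<Sum>i\<in>J. L i \<omega>) = m \<and> R \<omega>}"
    then have "(\<lambda>i\<in>J. L i \<omega>) \<in> ?V" "\<omega> \<in> ?F (\<lambda>i\<in>J. L i \<omega>)"
      using pos by auto
    then show "\<omega> \<in> (\<Union>v\<in>?V. ?F v)"
      by blast
  qed auto
  have "?F v \<in> events" for v
    using pred_and_Ball_eq[OF fin R L'] by simp
  \<comment> \<open>A common point of two events determines both vectors on \<open>J\<close>; being
    extensional, they are then equal.\<close>
  moreover have "disjoint_family_on ?F ?V"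
    unfolding disjoint_family_on_def by (auto simp: PiE_iff intro: extensionalityI)
  ultimately show ?thesis
    unfolding eq using finite_funcset_sum_eq[OF fin]
    by (intro finite_measure_finite_Union) auto
qed

lemma (in prob_space) prob_block_count_random_index_tendsto:
  assumes rp: "random_partition M \<pi>"
    and S: "\<And>t. 1 \<le> t \<Longrightarrow> S t \<in> measurable M (count_space {1..})"
    and Q: "Measurable.pred M Q"
    and conv: "AE \<omega> in M. \<forall>\<^sub>F t in sequentially. block_count \<pi> (S t \<omega>) \<omega> = k \<longleftrightarrow> Q \<omega>"
  shows "(\<lambda>t. \<P>(\<omega> in M. block_count \<pi> (S t \<omega>) \<omega> = k)) \<longlonglongrightarrow> \<P>(\<omega> in M. Q \<omega>)"
\<comment> \<open>Measurability of \<open>S t\<close> is available from \<open>t = 1\<close> on, so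
  the sequence is shifted by one.\<close>
proof (rule LIMSEQ_imp_Suc, rule prob_tendsto_of_AE_eventually_iff[OF _ Q])
  show "Measurable.pred M (\<lambda>\<omega>. block_count \<pi> (S (Suc t) \<omega>) \<omega> = k)" for t
    using measurable_block_count_random_index[OF rp S, of "Suc t"] by measurable
  show "AE \<omega> in M. \<forall>\<^sub>F t in sequentially. block_count \<pi> (S (Suc t) \<omega>) \<omega> = k \<longleftrightarrow> Q \<omega>"
    using conv by eventually_elim (rule eventually_compose_filterlim[OF _ filterlim_Suc])
qed

text \<open>Every summand is at least 1 and \<open>J\<close> is nonempty. The bound
  \<open>card J\<close> is what becomes the lower limit \<open>I\<close> in the series for the
  total.\<close>

lemma measurable_sum_ge_1:
  fixes L :: "'i \<Rightarrow> 'a \<Rightarrow> nat"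
  assumes "J \<noteq> {}" "finite J" "\<And>i. i \<in> J \<Longrightarrow> L i \<in> measurable M (count_space {1..})"
  shows "(\<lambda>\<omega>. \<Sum>i\<in>J. L i \<omega>) \<in> measurable M (count_space {1..})"
    and "\<And>\<omega>. \<omega> \<in> space M \<Longrightarrow> card J \<le> (\<Sum>i\<in>J. L i \<omega>)"
proof -
  have le: "card J \<le> (\<Sum>i\<in>J. L i \<omega>)" if "\<omega> \<in> space M" for \<omega>
    using sum_mono[of J "\<lambda>_. 1" "\<lambda>i. L i \<omega>"] measurable_space[OF assms(3) that] by simp
  then show "\<And>\<omega>. \<omega> \<in> space M \<Longrightarrow> card J \<le> (\<Sum>i\<in>J. L i \<omega>)" .
  have "1 \<le> card J"
    using assms by (simp add: Suc_le_eq card_gt_0_iff)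
  with le have "(\<Sum>i\<in>J. L i \<omega>) \<in> {1..}" if "\<omega> \<in> space M" for \<omega>
    using that by (force intro: order_trans)
  moreover have "(\<lambda>\<omega>. \<Sum>i\<in>J. L i \<omega>) \<in> measurable M (count_space UNIV)"
    using assms(2,3) measurable_count_space_UNIV[OF assms(3)]
  proof (induction J rule: finite_induct)
    case (insert i J)
    have [measurable]: "L i \<in> measurable M (count_space UNIV)"
      "(\<lambda>\<omega>. \<Sum>i\<in>J. L i \<omega>) \<in> measurable M (count_space UNIV)"
      using insert by auto
    show ?case
      unfolding sum.insert[OF insert.hyps] by measurable
  qed simp
  ultimately show "(\<lambda>\<omega>. \<Sum>i\<in>J. L i \<omega>) \<in> measurable M (count_space {1..})"
    by (simp add: measurable_count_space_eq2_countable vimage_def)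
qed

lemma (in prob_space) measurable_sum_K_group:
  assumes "\<And>i. i \<in> J \<Longrightarrow> random_partition M (\<pi> i)" "J \<noteq> {}" "finite J"
    and "\<And>i. i \<in> J \<Longrightarrow> 1 \<le> n i t"
  shows "(\<lambda>\<omega>. \<Sum>i\<in>J. K_group \<pi> n i t \<omega>) \<in> measurable M (count_space {1..})"
  unfolding K_group_def using assms by (intro measurable_sum_ge_1 measurable_block_count) auto

section \<open>Limit laws for a set of groups\<close>

text \<open>The random index is almost surely eventually the sum \<open>S\<close> of the limits, so
  the limit is the probability that \<open>\<pi> 0\<close> has \<open>k\<close> blocks at index
  \<open>S\<close>. This is expanded first over the values of \<open>S\<close>, then over the
  vectors of limits, and each term factors by independence.\<close>

lemma (in prob_space) prob_block_count_sum_tendsto_finite: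
  assumes rp: "\<And>i. i \<in> {0..I} \<Longrightarrow> random_partition M (\<pi> i)"
    and ind: "independent_partitions M \<pi> {0..I}"
    and J: "J \<subseteq> {1..I}" "J \<noteq> {}"
    and n1: "\<And>i t. i \<in> J \<Longrightarrow> 1 \<le> t \<Longrightarrow> 1 \<le> n i t"
    and n: "\<And>i. i \<in> J \<Longrightarrow> filterlim (n i) at_top sequentially"
    and K: "\<And>i. i \<in> J \<Longrightarrow>
      converges_as_to_positive M (\<lambda>N \<omega>. real (block_count (\<pi> i) N \<omega>)) (K i)"
    and k: "1 \<le> k"
  shows "(\<lambda>t. \<P>(\<omega> in M. block_count (\<pi> 0) (\<Sum>i\<in>J. K_group \<pi> n i t \<omega>) \<omega> = k))
    \<longlonglongrightarrow> (\<Sum>\<^sub>\<infinity>m\<in>{max (card J) k..}. \<Sum>v\<in>{v \<in> J \<rightarrow>\<^sub>E {1..}. (\<Sum>i\<in>J. v i) = m}.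
      q0 M \<pi> m k * (\<Prod>i\<in>J. \<P>(\<omega> in M. K i \<omega> = real (v i))))"
proof -
  \<comment> \<open>Truncation at 1 changes the limits only on a null set, and keeps all indices of
    \<open>\<pi> 0\<close> away from the unconstrained value \<open>\<pi> 0 0\<close>.\<close>
  define L where "L i \<omega> = max 1 (nat \<lfloor>K i \<omega>\<rfloor>)" for i \<omega>
  define S where "S \<omega> = (\<Sum>i\<in>J. L i \<omega>)" for \<omega>
  let ?V = "\<lambda>m. {v \<in> J \<rightarrow>\<^sub>E {1..}. (\<Sum>i\<in>J. v i) = m}"
  have fin: "finite J"
    using finite_subset[OF J(1)] by simp
  have rp0: "random_partition M (\<pi> 0)"
    by (simp add: rp)
  have L: "L i \<in> measurable M (count_space {1..})" if "i \<in> J" for i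
  proof -
    have [measurable]: "K i \<in> borel_measurable M"
      using K[OF that] by (simp add: converges_as_to_positive_def)
    have "L i \<in> measurable M (count_space UNIV)"
      unfolding L_def[abs_def] by measurable
    then show ?thesis
      by (rule measurable_count_space_extend[rotated -1]) (auto simp: L_def)
  qed
  have AE_L: "AE \<omega> in M. K i \<omega> = real (L i \<omega>) \<and>
      (\<forall>\<^sub>F N in sequentially. block_count (\<pi> i) N \<omega> = L i \<omega>)" if "i \<in> J" for i
  proof -
    have "AE \<omega> in M. 0 < K i \<omega>"
      and "AE \<omega> in M. (\<lambda>N. real (block_count (\<pi> i) N \<omega>)) \<longlonglongrightarrow> K i \<omega>"
      using K[OF that] by (auto simp: converges_as_to_positive_def)
    then show ?thesis
    proof eventually_elim
      case (elim \<omega>)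
      note lim = tendsto_of_nat_imp_eventually_eq[OF elim(2)]
      \<comment> \<open>A positive natural number is at least 1, so the truncation has no effect
        here.\<close>
      have "nat \<lfloor>K i \<omega>\<rfloor> = L i \<omega>"
        using lim(1) elim(1) by (simp add: L_def)
      then show ?case
        using lim by simp
    qed
  qed
  have S: "S \<in> measurable M (count_space {1..})"
    unfolding S_def[abs_def] by (rule measurable_sum_ge_1(1)[OF J(2) fin L])
  have S_ge: "card J \<le> S \<omega>" if "\<omega> \<in> space M" for \<omega>
    unfolding S_def by (rule measurable_sum_ge_1(2)[OF J(2) fin L that])
  have S1: "S \<omega> \<ge> 1" if "\<omega> \<in> space M" for \<omega>
    using measurable_space[OF S that] that by simp
  have lim: "(\<lambda>t. \<P>(\<omega> in M. block_count (\<pi> 0) (\<Sum>i\<in>J. K_group \<pi> n i t \<omega>) \<omega> = k))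
    \<longlonglongrightarrow> \<P>(\<omega> in M. block_count (\<pi> 0) (S \<omega>) \<omega> = k)"
  proof (rule prob_block_count_random_index_tendsto[OF rp0])
    show "(\<lambda>\<omega>. \<Sum>i\<in>J. K_group \<pi> n i t \<omega>) \<in> measurable M (count_space {1..})" if "1 \<le> t" for t
      using rp J fin n1 that by (intro measurable_sum_K_group) auto
    show "Measurable.pred M (\<lambda>\<omega>. block_count (\<pi> 0) (S \<omega>) \<omega> = k)"
      using measurable_block_count_random_index[OF rp0 S] by measurable
    have "AE \<omega> in M. \<forall>i\<in>J. \<forall>\<^sub>F N in sequentially. block_count (\<pi> i) N \<omega> = L i \<omega>"
      using AE_L fin by (auto simp: AE_finite_all)
    then show "AE \<omega> in M. \<forall>\<^sub>F t in sequentially.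
        (block_count (\<pi> 0) (\<Sum>i\<in>J. K_group \<pi> n i t \<omega>) \<omega> = k)
          = (block_count (\<pi> 0) (S \<omega>) \<omega> = k)"
    proof eventually_elim
      case (elim \<omega>)
      \<comment> \<open>Eventual equality in the sample size passes to \<open>t\<close> because
        \<open>n i\<close> diverges; finiteness of \<open>J\<close> gives one threshold for all
        groups.\<close>
      then have "\<forall>\<^sub>F t in sequentially. \<forall>i\<in>J. K_group \<pi> n i t \<omega> = L i \<omega>"
        using fin eventually_compose_filterlim[OF _ n]
        by (auto simp: eventually_ball_finite_distrib K_group_def)
      then show ?case
        by eventually_elim (simp add: S_def)
    qed
  qed
  \<comment> \<open>Terms below \<open>max (card J) k\<close> are absent: \<open>S\<close> is at
    least \<open>card J\<close>, and \<open>k\<close> blocks need an index of at least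
    \<open>k\<close>.\<close>
  have has_sum: "((\<lambda>m. \<P>(\<omega> in M. S \<omega> = m \<and> block_count (\<pi> 0) m \<omega> = k))
      has_sum \<P>(\<omega> in M. block_count (\<pi> 0) (S \<omega>) \<omega> = k)) {max (card J) k..}"
  proof (rule has_sum_prob_random_index)
    show "S \<in> measurable M (count_space UNIV)"
      by (rule measurable_count_space_UNIV[OF S])
    show "Measurable.pred M (\<lambda>\<omega>. block_count (\<pi> 0) m \<omega> = k)" if "m \<in> {max (card J) k..}" for m
    proof -
      have "1 \<le> m"
        using that k by simp
      from measurable_count_space_UNIV[OF measurable_block_count[OF rp0 this]] show ?thesis
        by measurable
    qed
    show "S \<omega> \<in> {max (card J) k..}"
      if "\<omega> \<in> space M" "block_count (\<pi> 0) (S \<omega>) \<omega> = k" for \<omega>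
      using block_count_le[OF rp0 S1] S_ge that by auto
  qed
  have terms: "\<P>(\<omega> in M. S \<omega> = m \<and> block_count (\<pi> 0) m \<omega> = k)
      = (\<Sum>v\<in>?V m. q0 M \<pi> m k * (\<Prod>i\<in>J. \<P>(\<omega> in M. K i \<omega> = real (v i))))"
    if m: "m \<in> {max (card J) k..}" for m
  proof -
    have m1: "1 \<le> m"
      using m k by simp
    have "\<P>(\<omega> in M. S \<omega> = m \<and> block_count (\<pi> 0) m \<omega> = k)
        = (\<Sum>v\<in>?V m. \<P>(\<omega> in M. block_count (\<pi> 0) m \<omega> = k \<and> (\<forall>i\<in>J. L i \<omega> = v i)))"
      unfolding S_def
    proof (rule prob_sum_eq_and[OF fin L])
      show "Measurable.pred M (\<lambda>\<omega>. block_count (\<pi> 0) m \<omega> = k)"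
        using measurable_count_space_UNIV[OF measurable_block_count[OF rp0 m1]] by measurable
    qed
    also have "\<dots> = (\<Sum>v\<in>?V m. q0 M \<pi> m k * (\<Prod>i\<in>J. \<P>(\<omega> in M. L i \<omega> = v i)))"
    proof (intro sum.cong refl prob_limit_block_counts_indep[OF rp ind J(1) m1])
      show "L i \<in> measurable M (count_space UNIV)" if "i \<in> J" for i
        by (rule measurable_count_space_UNIV[OF L[OF that]])
      show "AE \<omega> in M. \<forall>\<^sub>F N in sequentially. block_count (\<pi> i) N \<omega> = L i \<omega>" if "i \<in> J" for i
        using AE_L[OF that] by auto
    qed
    \<comment> \<open>The truncated integer limits are exchanged for the given real-valued ones,
      with which they agree almost surely.\<close>
    also have "\<dots> = (\<Sum>v\<in>?V m. q0 M \<pi> m k * (\<Prod>i\<in>J. \<P>(\<omega> in M. K i \<omega> = real (v i))))"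
    proof (intro sum.cong prod.cong refl arg_cong2[where f = "(*)"] prob_eq_AE)
      fix v i assume i: "i \<in> J"
      show "AE \<omega> in M. (L i \<omega> = v i) = (K i \<omega> = real (v i))"
        using AE_L[OF i] by auto
      show "{\<omega> \<in> space M. L i \<omega> = v i} \<in> events"
        using measurable_count_space_UNIV[OF L[OF i]] by measurable
      have [measurable]: "K i \<in> borel_measurable M"
        using K[OF i] by (simp add: converges_as_to_positive_def)
      show "{\<omega> \<in> space M. K i \<omega> = real (v i)} \<in> events"
        by measurable
    qed
    finally show ?thesis .
  qed
  have "\<P>(\<omega> in M. block_count (\<pi> 0) (S \<omega>) \<omega> = k)
      = (\<Sum>\<^sub>\<infinity>m\<in>{max (card J) k..}. \<Sum>v\<in>?V m.
          q0 M \<pi> m k * (\<Prod>i\<in>J. \<P>(\<omega> in M. K i \<omega> = real (v i))))"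
    unfolding infsumI[OF has_sum, symmetric] by (rule infsum_cong) (rule terms)
  with lim show ?thesis
    by (simp only:)
qed

text \<open>The block count of a single group already tends to infinity almost surely, hence so does
  the sum. Along a diverging index the block count of \<open>\<pi> 0\<close> is eventually equal to
  its limit \<open>K0\<close>.\<close>

lemma (in prob_space) prob_block_count_sum_tendsto_infinite:
  assumes rp0: "random_partition M (\<pi> 0)"
    and rp: "\<And>i. i \<in> J \<Longrightarrow> random_partition M (\<pi> i)"
    and J: "J \<noteq> {}" "finite J"
    and n1: "\<And>i t. i \<in> J \<Longrightarrow> 1 \<le> t \<Longrightarrow> 1 \<le> n i t"
    and n: "\<And>i. i \<in> J \<Longrightarrow> filterlim (n i) at_top sequentially"
    and b: "\<And>i. i \<in> J \<Longrightarrow> filterlim (b i) at_top sequentially"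
    and Dinf: "\<And>i. i \<in> J \<Longrightarrow>
      converges_as_to_positive M (\<lambda>N \<omega>. real (block_count (\<pi> i) N \<omega>) / b i N) (Dinf i)"
    and K0: "converges_as_to_positive M (\<lambda>N \<omega>. real (block_count (\<pi> 0) N \<omega>)) K0"
  shows "(\<lambda>t. \<P>(\<omega> in M. block_count (\<pi> 0) (\<Sum>i\<in>J. K_group \<pi> n i t \<omega>) \<omega> = k))
    \<longlonglongrightarrow> \<P>(\<omega> in M. K0 \<omega> = real k)"
proof (rule prob_block_count_random_index_tendsto[OF rp0])
  show "(\<lambda>\<omega>. \<Sum>i\<in>J. K_group \<pi> n i t \<omega>) \<in> measurable M (count_space {1..})" if "1 \<le> t" for t
    using rp J n1 that by (intro measurable_sum_K_group) auto
  have [measurable]: "K0 \<in> borel_measurable M"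
    using K0 by (simp add: converges_as_to_positive_def)
  show "Measurable.pred M (\<lambda>\<omega>. K0 \<omega> = real k)"
    by measurable
  obtain i where i: "i \<in> J"
    using J by auto
  have "AE \<omega> in M. (\<lambda>N. real (block_count (\<pi> 0) N \<omega>)) \<longlonglongrightarrow> K0 \<omega>"
    and "AE \<omega> in M. 0 < Dinf i \<omega>"
    and "AE \<omega> in M. (\<lambda>N. real (block_count (\<pi> i) N \<omega>) / b i N) \<longlonglongrightarrow> Dinf i \<omega>"
    using K0 Dinf[OF i] by (auto simp: converges_as_to_positive_def)
  then show "AE \<omega> in M. \<forall>\<^sub>F t in sequentially.
      (block_count (\<pi> 0) (\<Sum>i\<in>J. K_group \<pi> n i t \<omega>) \<omega> = k) = (K0 \<omega> = real k)"
  proof eventually_elim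
    case (elim \<omega>)
    note lim = tendsto_of_nat_imp_eventually_eq[OF elim(1)]
    \<comment> \<open>A positive limit times the diverging \<open>b i\<close> diverges; the factor
      \<open>b i N\<close> then cancels wherever it is nonzero, which is eventually the
      case.\<close>
    have "filterlim (\<lambda>N. real (block_count (\<pi> i) N \<omega>) / b i N * b i N) at_top sequentially"
      by (rule filterlim_tendsto_pos_mult_at_top[OF elim(3,2) b[OF i]])
    moreover have "\<forall>\<^sub>F N in sequentially. b i N > 0"
      using b[OF i] by (simp add: filterlim_at_top_dense)
    then have "\<forall>\<^sub>F N in sequentially.
        real (block_count (\<pi> i) N \<omega>) / b i N * b i N = real (block_count (\<pi> i) N \<omega>)"
      by eventually_elim simp
    ultimately have "filterlim (\<lambda>N. real (block_count (\<pi> i) N \<omega>)) at_top sequentially"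
      by (rule filterlim_cong[OF refl refl, THEN iffD1, rotated])
    then have "filterlim (\<lambda>N. block_count (\<pi> i) N \<omega>) at_top sequentially"
      by (simp add: filterlim_sequentially_iff_filterlim_real)
    from filterlim_compose[OF this n[OF i]]
    have "filterlim (\<lambda>t. K_group \<pi> n i t \<omega>) at_top sequentially"
      by (simp add: K_group_def)
    then have "filterlim (\<lambda>t. \<Sum>i\<in>J. K_group \<pi> n i t \<omega>) at_top sequentially"
      by (rule filterlim_at_top_mono)
        (use member_le_sum[OF i, of "\<lambda>i. K_group \<pi> n i _ \<omega>"] J in simp)
    \<comment> \<open>\<open>lim(2)\<close> fixes the count of \<open>\<pi> 0\<close> at all large
      indices, and \<open>lim(1)\<close> identifies \<open>K0 \<omega>\<close> with that natural
      number, so both equalities with \<open>k\<close> agree.\<close>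
    from eventually_compose_filterlim[OF lim(2) this] show ?case
      by eventually_elim (metis lim(1) of_nat_eq_iff)
  qed
qed

section \<open>Specialization to single groups and to the total\<close>

theorem proposition10:
  fixes M :: "'a measure"
    and \<pi> :: "nat \<Rightarrow> nat \<Rightarrow> 'a \<Rightarrow> nat set set"
    and I :: nat
    and n :: "nat \<Rightarrow> nat \<Rightarrow> nat"
    and K :: "nat \<Rightarrow> 'a \<Rightarrow> real"
    and K0 :: "'a \<Rightarrow> real"
    and Dinf :: "nat \<Rightarrow> 'a \<Rightarrow> real"
    and b :: "nat \<Rightarrow> nat \<Rightarrow> real"
  assumes "prob_space M"
    and "1 \<le> I"
    and "\<And>i. i \<in> {0..I} \<Longrightarrow> random_partition M (\<pi> i)"
    and "\<And>i. i \<in> {0..I} \<Longrightarrow> exchangeable M (\<pi> i)"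
    and "independent_partitions M \<pi> {0..I}"
    and "\<And>i t. i \<in> {1..I} \<Longrightarrow> 1 \<le> t \<Longrightarrow> 1 \<le> n i t"
    and "\<And>i. i \<in> {1..I} \<Longrightarrow> filterlim (n i) at_top sequentially"
  shows
    "((\<forall>i\<in>{1..I}. converges_as_to_positive M (\<lambda>N \<omega>. real (block_count (\<pi> i) N \<omega>)) (K i))
      \<longrightarrow> (\<forall>k\<ge>1.
            (\<forall>i\<in>{1..I}.
               (\<lambda>t. \<P>(\<omega> in M. D_group \<pi> n i t \<omega> = k))
                 \<longlonglongrightarrow> (\<Sum>\<^sub>\<infinity>m\<in>{k..}. \<P>(\<omega> in M. K i \<omega> = real m) * q0 M \<pi> m k)) \<and>
            (\<lambda>t. \<P>(\<omega> in M. D_total \<pi> n I t \<omega> = k))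
              \<longlonglongrightarrow> (\<Sum>\<^sub>\<infinity>m\<in>{max I k..}.
                     \<Sum>v\<in>{v \<in> {1..I} \<rightarrow>\<^sub>E {1..}. (\<Sum>i\<in>{1..I}. v i) = m}.
                       q0 M \<pi> m k * (\<Prod>i\<in>{1..I}. \<P>(\<omega> in M. K i \<omega> = real (v i))))))
     \<and>
     ((\<forall>i\<in>{1..I}. filterlim (b i) at_top sequentially \<and>
          converges_as_to_positive M (\<lambda>N \<omega>. real (block_count (\<pi> i) N \<omega>) / b i N) (Dinf i)) \<and>
      converges_as_to_positive M (\<lambda>N \<omega>. real (block_count (\<pi> 0) N \<omega>)) K0
      \<longrightarrow> (\<forall>k\<ge>1.
            (\<lambda>t. \<P>(\<omega> in M. D_total \<pi> n I t \<omega> = k)) \<longlonglongrightarrow> \<P>(\<omega> in M. K0 \<omega> = real k) \<and>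
            (\<forall>i\<in>{1..I}.
               (\<lambda>t. \<P>(\<omega> in M. D_group \<pi> n i t \<omega> = k)) \<longlonglongrightarrow> \<P>(\<omega> in M. K0 \<omega> = real k))))"
proof -
  interpret prob_space M by fact
  have I: "{1..I} \<noteq> {}"
    using \<open>1 \<le> I\<close> by simp
  have rp0: "random_partition M (\<pi> 0)"
    using assms(3) by simp
  show ?thesis
  proof (intro conjI impI allI ballI)
    fix k :: nat and i
    assume K: "\<forall>i\<in>{1..I}. converges_as_to_positive M (\<lambda>N \<omega>. real (block_count (\<pi> i) N \<omega>)) (K i)"
      and k: "1 \<le> k" and i: "i \<in> {1..I}"
    \<comment> \<open>For one group the inner sum has a single term; \<open>1 \<le> m\<close>
      ensures that the vector with value \<open>m\<close> lies in the function space.\<close>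
    have V: "{v \<in> {i} \<rightarrow>\<^sub>E {1..}. (\<Sum>i\<in>{i}. v i) = m} = {\<lambda>_\<in>{i}. m}" if "1 \<le> m" for m :: nat
    proof -
      have "{v \<in> {i} \<rightarrow>\<^sub>E {1..}. (\<Sum>i\<in>{i}. v i) = m} = {v \<in> {i} \<rightarrow>\<^sub>E {1..}. v i = m}"
        by simp
      also have "\<dots> = {\<lambda>_\<in>{i}. m}"
        unfolding PiE_over_singleton_iff using that by auto
      finally show ?thesis .
    qed
    have terms: "(\<Sum>v\<in>{v \<in> {i} \<rightarrow>\<^sub>E {1..}. (\<Sum>i\<in>{i}. v i) = m}.
          q0 M \<pi> m k * (\<Prod>i\<in>{i}. \<P>(\<omega> in M. K i \<omega> = real (v i))))
        = \<P>(\<omega> in M. K i \<omega> = real m) * q0 M \<pi> m k" if "m \<in> {k..}" for m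
    proof -
      have "1 \<le> m"
        using that k by simp
      then show ?thesis
        unfolding V[OF \<open>1 \<le> m\<close>] by simp
    qed
    have "(\<lambda>t. \<P>(\<omega> in M. block_count (\<pi> 0) (\<Sum>i\<in>{i}. K_group \<pi> n i t \<omega>) \<omega> = k))
      \<longlonglongrightarrow> (\<Sum>\<^sub>\<infinity>m\<in>{max (card {i}) k..}. \<Sum>v\<in>{v \<in> {i} \<rightarrow>\<^sub>E {1..}. (\<Sum>i\<in>{i}. v i) = m}.
        q0 M \<pi> m k * (\<Prod>i\<in>{i}. \<P>(\<omega> in M. K i \<omega> = real (v i))))"
      using i k K assms(3,5,6,7) by (intro prob_block_count_sum_tendsto_finite[where I = I]) auto
    also have "(\<Sum>\<^sub>\<infinity>m\<in>{max (card {i}) k..}. \<Sum>v\<in>{v \<in> {i} \<rightarrow>\<^sub>E {1..}. (\<Sum>i\<in>{i}. v i) = m}.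
        q0 M \<pi> m k * (\<Prod>i\<in>{i}. \<P>(\<omega> in M. K i \<omega> = real (v i))))
      = (\<Sum>\<^sub>\<infinity>m\<in>{k..}. \<P>(\<omega> in M. K i \<omega> = real m) * q0 M \<pi> m k)"
    proof -
      \<comment> \<open>A single group contributes the lower bound 1, which \<open>k\<close> already
        meets.\<close>
      have "max (card {i}) k = k"
        using k by simp
      then show ?thesis
        by (simp only:) (rule infsum_cong, rule terms)
    qed
    finally show "(\<lambda>t. \<P>(\<omega> in M. D_group \<pi> n i t \<omega> = k))
        \<longlonglongrightarrow> (\<Sum>\<^sub>\<infinity>m\<in>{k..}. \<P>(\<omega> in M. K i \<omega> = real m) * q0 M \<pi> m k)"
      by (simp add: D_group_def)
  next
    fix k :: nat
    assume K: "\<forall>i\<in>{1..I}. converges_as_to_positive M (\<lambda>N \<omega>. real (block_count (\<pi> i) N \<omega>)) (K i)"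
      and k: "1 \<le> k"
    show "(\<lambda>t. \<P>(\<omega> in M. D_total \<pi> n I t \<omega> = k))
        \<longlonglongrightarrow> (\<Sum>\<^sub>\<infinity>m\<in>{max I k..}.
          \<Sum>v\<in>{v \<in> {1..I} \<rightarrow>\<^sub>E {1..}. (\<Sum>i\<in>{1..I}. v i) = m}.
            q0 M \<pi> m k * (\<Prod>i\<in>{1..I}. \<P>(\<omega> in M. K i \<omega> = real (v i))))"
      using prob_block_count_sum_tendsto_finite[where K = K, OF assms(3,5) subset_refl I assms(6,7) _ k] K
      by (simp add: D_total_def K_total_def)
  next
    fix k :: nat
    assume "(\<forall>i\<in>{1..I}. filterlim (b i) at_top sequentially \<and>
          converges_as_to_positive M (\<lambda>N \<omega>. real (block_count (\<pi> i) N \<omega>) / b i N) (Dinf i)) \<and>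
      converges_as_to_positive M (\<lambda>N \<omega>. real (block_count (\<pi> 0) N \<omega>)) K0"
    note bD = conjunct1[OF this] and K0 = conjunct2[OF this]
    \<comment> \<open>Stated for a general \<open>J\<close>, to be used with \<open>{1..I}\<close>
      for the total and with \<open>{i}\<close> for a group.\<close>
    have lim: "(\<lambda>t. \<P>(\<omega> in M. block_count (\<pi> 0) (\<Sum>i\<in>J. K_group \<pi> n i t \<omega>) \<omega> = k))
        \<longlonglongrightarrow> \<P>(\<omega> in M. K0 \<omega> = real k)" if "J \<subseteq> {1..I}" "J \<noteq> {}" for J
      using that bD K0 assms(3,6,7) rp0 finite_subset[OF that(1)]
      by (intro prob_block_count_sum_tendsto_infinite[where b = b and Dinf = Dinf]) auto
    show "(\<lambda>t. \<P>(\<omega> in M. D_total \<pi> n I t \<omega> = k)) \<longlonglongrightarrow> \<P>(\<omega> in M. K0 \<omega> = real k)"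
      using lim[OF subset_refl I] by (simp add: D_total_def K_total_def)
    show "(\<lambda>t. \<P>(\<omega> in M. D_group \<pi> n i t \<omega> = k)) \<longlonglongrightarrow> \<P>(\<omega> in M. K0 \<omega> = real k)"
      if "i \<in> {1..I}" for i
      using lim[of "{i}"] that by (simp add: D_group_def)
  qed
qed

end
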